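(* Let $t\le k$ be positive integers and $n,s\ge0$ integers. The number of words $w\in[k]^n$ with $\overleftarrow{\mathrm{des}}_{[t]}(w)=s$, which also equals the number of words $w\in[k]^n$ with $\overleftarrow{\mathrm{ris}}_{\{k+1-t,\ldots,k\}}(w)=s$, is $$\sum_{m=0}^n\sum_{a=0}^m\sum_{b=0}^{m-a}(-1)^{n-a-b-s}\binom{m}{a}\binom{m-a}{b}\binom{ta}{n-b}\binom{n-m}{s}(k-t)^b.$$
   Context: $[k]=\{1,\ldots,k\}$, $[k]^n$ is the set of words of length $n$ over $[k]$. For a word $w=w_1\cdots w_n$ and $X\subseteq\mathbb{N}$, $\overleftarrow{\mathrm{des}}_X(w)=|\{i:w_i>w_{i+1},\ w_i\in X\}|$ and $\overleftarrow{\mathrm{ris}}_X(w)=|\{i:w_i<w_{i+1},\ w_i\in X\}|$. Conventions: $\binom{a}{b}=0$ if $b<0$ or $b>a$ (for $a\ge0$), and $0^0=1$. *)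

theory Defs
  imports Complex_Main
begin

definition words :: "nat \<Rightarrow> nat \<Rightarrow> nat list set" where
  "words k n = {w. length w = n \<and> set w \<subseteq> {1..k}}"

(* List positions are 0-based: w ! i is the letter with index i + 1. *)

definition des_left :: "nat set \<Rightarrow> nat list \<Rightarrow> nat" where
  "des_left X w = card {i. Suc i < length w \<and> w ! i > w ! Suc i \<and> w ! i \<in> X}"

definition ris_left :: "nat set \<Rightarrow> nat list \<Rightarrow> nat" where
  "ris_left X w = card {i. Suc i < length w \<and> w ! i < w ! Suc i \<and> w ! i \<in> X}"

end

theory Submission
  imports
    Defs
    "HOL-Computational_Algebra.Polynomial_FPS"
begin

text \<open>Weight each word by \<open>z ^ des\<close>. Writing \<open>z = 1 + (z - 1)\<close> amounts to summing over all sets of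
  marked descents, each mark having weight \<open>z - 1\<close>. The marks cut a word into clusters, the
  maximal runs of letters joined by marked descents: a cluster is a letter \<open>c\<close> preceded by a set of
  larger letters of \<open>X\<close> in decreasing order. If \<open>C\<close> counts clusters by their marks, then a word of
  length \<open>n\<close> with \<open>m\<close> clusters has \<open>n - m\<close> marks, so the total weight is the sum over \<open>m\<close> of
  \<open>(z - 1) ^ (n - m)\<close> times the coefficient of degree \<open>n - m\<close> in \<open>C ^ m\<close>. For \<open>X = {1..t}\<close> the sum
  over \<open>c\<close> is geometric and \<open>x C = (k - t) x + (1 + x) ^ t - 1\<close>, whose powers expand to the formula.
  Rises become descents under the complement \<open>x \<mapsto> k + 1 - x\<close> of letters.\<close>

unbundle fps_syntax

subsection \<open>Binomial sums and power series\<close>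

lemma sum_card_greater_choose:
  fixes S :: "'a::linorder set"
  assumes "finite S"
  shows "(\<Sum>x\<in>S. card {y \<in> S. x < y} choose i) = card S choose Suc i"
  using assms
proof (induction rule: finite_linorder_min_induct)
  case empty
  then show ?case by simp
next
  case (insert b S)
  have "{y \<in> insert b S. b < y} = S"
    using insert.hyps by auto
  moreover have "{y \<in> insert b S. x < y} = {y \<in> S. x < y}" if "x \<in> S" for x
    using insert.hyps that by (auto dest: less_asym)
  ultimately show ?case
    using insert by (auto simp: card_insert_if)
qed

lemma trinomial_ring:
  fixes x y z :: "'a::comm_semiring_1"
  shows "(x + y + z) ^ m = (\<Sum>a\<le>m. \<Sum>b\<le>m - a.
           of_nat ((m choose a) * ((m - a) choose b)) * x ^ a * y ^ b * z ^ (m - a - b))"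
  by (simp add: add.assoc[of x] binomial_ring sum_distrib_left mult_ac)

lemma coeff_linear_poly_power_choose:
  fixes a b :: "'a::comm_semiring_1"
  shows "coeff ([:a, b:] ^ n) i = of_nat (n choose i) * b ^ i * a ^ (n - i)"
proof (cases "i \<le> n")
  case True
  then show ?thesis by (rule coeff_linear_poly_power)
next
  case False
  moreover have "degree ([:a, b:] ^ n) \<le> n"
    using degree_power_le[of "[:a, b:]" n] degree_pCons_le[of a "[:b:]"]
    by (auto intro: order_trans mult_le_mono1)
  ultimately show ?thesis by (simp add: coeff_eq_0 binomial_eq_0)
qed

lemma fps_nth_one_plus_X_power:
  "((1 + fps_X) ^ n :: 'a::comm_ring_1 fps) $ i = of_nat (n choose i)"
proof -
  have "(1 + fps_X) ^ n = fps_of_poly ([:1, 1 :: 'a:] ^ n)"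
    by (simp add: fps_of_poly_power fps_of_poly_pCons add.commute)
  then show ?thesis
    by (simp only: fps_of_poly_nth coeff_linear_poly_power_choose power_one mult_1_right)
qed

lemma fps_nth_of_X_recurrence:
  fixes F p :: "'a::comm_ring_1 fps"
  assumes "F = 1 + fps_X * p * F"
  shows "F $ n = (\<Sum>m\<le>n. (p ^ m) $ (n - m))"
proof -
  let ?h = "fps_X * p"
  have inverse: "(1 - ?h) * F = 1"
    using assms by (simp add: algebra_simps)
  have "F = (1 - ?h ^ Suc n) * F + ?h ^ Suc n * F"
    by (simp add: algebra_simps)
  also have "(1 - ?h ^ Suc n) * F = (\<Sum>m\<le>n. ?h ^ m) * ((1 - ?h) * F)"
    by (simp only: sum_gp_basic[symmetric] mult_ac)
  also have "\<dots> = (\<Sum>m\<le>n. ?h ^ m)"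
    by (simp add: inverse)
  also have "?h ^ Suc n * F = fps_X ^ Suc n * (p ^ Suc n * F)"
    by (simp only: power_mult_distrib mult.assoc)
  finally have "F $ n = ((\<Sum>m\<le>n. ?h ^ m) + fps_X ^ Suc n * (p ^ Suc n * F)) $ n"
    by (rule arg_cong)
  also have "\<dots> = (\<Sum>m\<le>n. (fps_X ^ m * p ^ m) $ n)"
    by (simp add: fps_sum_nth power_mult_distrib fps_X_power_mult_nth del: power_Suc)
  also have "\<dots> = (\<Sum>m\<le>n. (p ^ m) $ (n - m))"
    by (intro sum.cong) (simp_all add: fps_X_power_mult_nth)
  finally show ?thesis .
qed

subsection \<open>Words and descents\<close>

lemma words_0: "words k 0 = {[]}"
  by (auto simp: words_def)

lemma words_Suc: "words k (Suc n) = (\<lambda>(w, c). w @ [c]) ` (words k n \<times> {1..k})"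
  by (auto simp: words_def length_Suc_conv_rev image_iff)

lemma finite_words [simp]: "finite (words k n)"
  by (induction n) (auto simp: words_0 words_Suc)

lemma sum_words_Suc:
  "(\<Sum>w\<in>words k (Suc n). f w) = (\<Sum>c=1..k. \<Sum>w\<in>words k n. f (w @ [c]))"
proof -
  have "inj_on (\<lambda>(w, c). w @ [c]) (words k n \<times> {1..k})"
    by (auto simp: inj_on_def)
  then have "(\<Sum>w\<in>words k (Suc n). f w) = (\<Sum>w\<in>words k n. \<Sum>c=1..k. f (w @ [c]))"
    by (simp add: words_Suc sum.reindex sum.cartesian_product case_prod_unfold)
  then show ?thesis
    by (simp add: sum.swap[of _ "words k n"])
qed

lemma des_left_Nil: "des_left X [] = 0"
  by (simp add: des_left_def)

lemma des_left_singleton: "des_left X [c] = 0"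
  by (simp add: des_left_def)

lemma des_left_snoc:
  "des_left X (w @ [d, c]) = des_left X (w @ [d]) + of_bool (d \<in> X \<inter> {c<..})"
proof -
  let ?D = "\<lambda>w. {i. Suc i < length w \<and> w ! i > w ! Suc i \<and> w ! i \<in> X}"
  have "?D (w @ [d, c]) = ?D (w @ [d]) \<union> (if d \<in> X \<inter> {c<..} then {length w} else {})"
    (is "?A = ?B")
  proof (rule set_eqI)
    fix i
    consider "Suc i < length w" | "Suc i = length w" | "i = length w" | "i > length w"
      by linarith
    then show "i \<in> ?A \<longleftrightarrow> i \<in> ?B"
      by cases (auto simp: nth_append)
  qed
  moreover have "finite (?D (w @ [d]))"
    by (rule finite_subset[of _ "{..length w}"]) auto
  ultimately show ?thesis
    by (auto simp: des_left_def card_insert_if)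
qed

subsection \<open>The cluster expansion\<close>

definition des_fps :: "'a::comm_ring_1 \<Rightarrow> nat set \<Rightarrow> nat \<Rightarrow> 'a fps" where
  "des_fps z X k = Abs_fps (\<lambda>n. \<Sum>w\<in>words k n. z ^ des_left X w)"

text \<open>The summand with index \<open>c\<close> counts the clusters ending in \<open>c\<close>, by the number of marks.\<close>

definition cluster_fps :: "nat set \<Rightarrow> nat \<Rightarrow> 'a::comm_ring_1 fps" where
  "cluster_fps X k = (\<Sum>c=1..k. (1 + fps_X) ^ card (X \<inter> {c<..k}))"

lemma des_fps_nth_0: "des_fps z X k $ 0 = 1"
  by (simp add: des_fps_def words_0 des_left_Nil)

lemma des_fps_nth_Suc:
  "des_fps z X k $ Suc n = (\<Sum>c=1..k. \<Sum>w\<in>words k n. z ^ des_left X (w @ [c]))"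
  by (simp add: des_fps_def sum_words_Suc)

lemma sum_words_last_letter_Suc:
  fixes z :: "'a::comm_ring_1"
  shows "(\<Sum>w\<in>words k (Suc n). z ^ des_left X (w @ [c]))
           = des_fps z X k $ Suc n
             + (\<Sum>d\<in>X \<inter> {c<..k}. (z - 1) * (\<Sum>w\<in>words k n. z ^ des_left X (w @ [d])))"
proof -
  let ?W = "\<lambda>d. \<Sum>w\<in>words k n. z ^ des_left X (w @ [d])"
  have "(\<Sum>w\<in>words k (Suc n). z ^ des_left X (w @ [c]))
      = (\<Sum>d=1..k. ?W d + (if d \<in> X \<inter> {c<..k} then (z - 1) * ?W d else 0))"
    unfolding sum_words_Suc
    by (intro sum.cong)
       (auto simp: des_left_snoc algebra_simps sum_distrib_left sum_subtractf[symmetric] sum.distrib[symmetric])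
  also have "\<dots> = des_fps z X k $ Suc n + (\<Sum>d\<in>{1..k} \<inter> (X \<inter> {c<..k}). (z - 1) * ?W d)"
    by (simp only: des_fps_nth_Suc sum.distrib sum.inter_restrict[OF finite_atLeastAtMost])
  also have "{1..k} \<inter> (X \<inter> {c<..k}) = X \<inter> {c<..k}"
    by auto
  finally show ?thesis .
qed

text \<open>The summand with index \<open>i\<close> collects the marked words whose last cluster has \<open>i\<close> letters
  before \<open>c\<close>.\<close>

lemma sum_words_last_letter:
  fixes z :: "'a::comm_ring_1"
  shows "(\<Sum>w\<in>words k n. z ^ des_left X (w @ [c]))
           = (\<Sum>i\<le>n. (z - 1) ^ i * of_nat (card (X \<inter> {c<..k}) choose i) * des_fps z X k $ (n - i))"
proof (induction n arbitrary: c)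
  case 0
  show ?case
    by (simp add: words_0 des_left_singleton des_fps_nth_0)
next
  case (Suc n)
  let ?S = "X \<inter> {c<..k}"
  have finite: "finite ?S"
    by simp
  let ?f = "\<lambda>i. (z - 1) ^ Suc i * des_fps z X k $ (n - i)"
  have tail: "X \<inter> {d<..k} = {y \<in> ?S. d < y}" if "d \<in> ?S" for d
    using that by auto
  have "(\<Sum>d\<in>?S. (z - 1) * (\<Sum>w\<in>words k n. z ^ des_left X (w @ [d])))
      = (\<Sum>d\<in>?S. \<Sum>i\<le>n. of_nat (card {y \<in> ?S. d < y} choose i) * ?f i)"
    unfolding Suc.IH by (intro sum.cong refl) (simp add: tail sum_distrib_left mult_ac)
  also have "\<dots> = (\<Sum>i\<le>n. of_nat (\<Sum>d\<in>?S. card {y \<in> ?S. d < y} choose i) * ?f i)"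
    by (subst sum.swap) (simp add: sum_distrib_right)
  also have "\<dots> = (\<Sum>i\<le>n. of_nat (card ?S choose Suc i) * ?f i)"
    by (simp only: sum_card_greater_choose[OF finite])
  finally show ?case
    unfolding sum_words_last_letter_Suc by (subst sum.atMost_Suc_shift) (simp add: mult_ac)
qed

lemma cluster_fps_nth:
  "cluster_fps X k $ i = (\<Sum>c=1..k. of_nat (card (X \<inter> {c<..k}) choose i))"
  by (simp add: cluster_fps_def fps_sum_nth fps_nth_one_plus_X_power)

lemma des_fps_recurrence:
  "des_fps z X k
     = 1 + fps_X * (cluster_fps X k oo (fps_const (z - 1) * fps_X)) * des_fps z X k"
proof (rule fps_ext)
  let ?C = "cluster_fps X k oo (fps_const (z - 1) * fps_X)"
  show "des_fps z X k $ n = (1 + fps_X * ?C * des_fps z X k) $ n" for n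
  proof (cases n)
    case 0
    then show ?thesis by (simp add: des_fps_nth_0)
  next
    case (Suc n')
    have "des_fps z X k $ Suc n' = (\<Sum>i\<le>n'. ?C $ i * des_fps z X k $ (n' - i))"
      unfolding des_fps_nth_Suc sum_words_last_letter
      by (subst sum.swap) (simp add: cluster_fps_nth sum_distrib_left sum_distrib_right)
    with Suc show ?thesis
      by (simp add: mult.assoc fps_mult_nth[of ?C] atLeast0AtMost)
  qed
qed

theorem des_fps_nth:
  fixes z :: "'a::idom"
  shows "des_fps z X k $ n = (\<Sum>m\<le>n. (z - 1) ^ (n - m) * (cluster_fps X k ^ m) $ (n - m))"
  by (subst fps_nth_of_X_recurrence[OF des_fps_recurrence]) (simp add: fps_compose_power)

text \<open>The exponent \<open>n - m - s\<close> is truncated only where the binomial coefficient vanishes.\<close>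

theorem card_des_left:
  "(of_nat (card {w \<in> words k n. des_left X w = s}) :: 'a::{idom, ring_char_0})
     = (\<Sum>m\<le>n. (- 1) ^ (n - m - s) * of_nat ((n - m) choose s)
                * (cluster_fps X k ^ m) $ (n - m))"
proof -
  let ?C = "\<lambda>m. (cluster_fps X k ^ m) $ (n - m) :: 'a"
  let ?P = "\<Sum>w\<in>words k n. monom 1 (des_left X w) :: 'a poly"
  have "?P = (\<Sum>m\<le>n. smult (?C m) ([:- 1, 1:] ^ (n - m)))"
  proof (rule poly_ext)
    show "poly ?P z = poly (\<Sum>m\<le>n. smult (?C m) ([:- 1, 1:] ^ (n - m))) z" for z
      using des_fps_nth[of z X k n] by (simp add: des_fps_def poly_sum poly_monom mult.commute)
  qed
  then have "coeff ?P s = coeff (\<Sum>m\<le>n. smult (?C m) ([:- 1, 1:] ^ (n - m))) s"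
    by simp
  moreover have "coeff ?P s = of_nat (card {w \<in> words k n. des_left X w = s})"
    by (simp add: coeff_sum sum.If_cases Int_def)
  ultimately show ?thesis
    by (simp add: coeff_sum coeff_linear_poly_power_choose mult_ac)
qed

subsection \<open>Clusters for an initial segment of letters\<close>

lemma X_mult_cluster_fps_initial:
  assumes "t \<le> k"
  shows "fps_X * cluster_fps {1..t} k
           = ((1 + fps_X) ^ t + of_nat (k - t) * fps_X + (- 1) :: 'a::comm_ring_1 fps)"
proof -
  have letters: "{1..k} = {1..t} \<union> {Suc t..k}"
    using assms by auto
  let ?Y = "1 + fps_X :: 'a fps"
  have "cluster_fps {1..t} k = (\<Sum>c=1..k. ?Y ^ (t - c))"
    unfolding cluster_fps_def
  proof (rule sum.cong[OF refl])
    fix c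
    have "{1..t} \<inter> {c<..k} = {c<..t}"
      using assms by auto
    then show "?Y ^ card ({1..t} \<inter> {c<..k}) = ?Y ^ (t - c)"
      by simp
  qed
  also have "\<dots> = (\<Sum>c=1..t. ?Y ^ (t - c)) + of_nat (k - t)"
    unfolding letters by (subst sum.union_disjoint) auto
  also have "(\<Sum>c=1..t. ?Y ^ (t - c)) = (\<Sum>j<t. ?Y ^ j)"
    by (rule sum.reindex_bij_witness[of _ "\<lambda>j. t - j" "\<lambda>c. t - c"]) auto
  finally have "fps_X * cluster_fps {1..t} k
      = fps_X * (\<Sum>j<t. ?Y ^ j) + of_nat (k - t) * fps_X"
    by (simp add: algebra_simps)
  also have "fps_X * (\<Sum>j<t. ?Y ^ j) = ?Y ^ t - 1"
    using power_diff_1_eq[of ?Y t] by simp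
  finally show ?thesis
    by simp
qed

lemma cluster_fps_initial_power_nth:
  assumes "t \<le> k" "m \<le> n"
  shows "(cluster_fps {1..t} k ^ m :: 'a::comm_ring_1 fps) $ (n - m)
           = (\<Sum>a\<le>m. \<Sum>b\<le>m - a. (- 1) ^ (m - a - b) * of_nat ((m choose a) * ((m - a) choose b))
                * of_nat ((t * a) choose (n - b)) * of_nat (k - t) ^ b)"
proof -
  let ?Y = "(1 + fps_X) ^ t :: 'a fps" and ?V = "of_nat (k - t) * fps_X :: 'a fps"
  have term_nth: "(of_nat N * ?Y ^ a * ?V ^ b * (- 1) ^ e) $ n
      = (- 1) ^ e * of_nat N * of_nat ((t * a) choose (n - b)) * of_nat (k - t) ^ b"
    if "b \<le> n" for N a b e
  proof -
    have "of_nat N * ?Y ^ a * ?V ^ b * (- 1) ^ e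
        = fps_const ((- 1) ^ e * of_nat N * of_nat (k - t) ^ b)
          * (fps_X ^ b * (1 + fps_X) ^ (t * a))"
      by (simp add: power_mult[symmetric] power_mult_distrib fps_of_nat[symmetric] fps_const_neg[symmetric]
            fps_const_mult[symmetric] fps_const_power[symmetric] mult_ac
            del: fps_const_mult fps_const_power fps_const_neg)
    then show ?thesis
      using that by (simp only: fps_mult_left_const_nth fps_X_power_mult_nth)
        (simp add: fps_nth_one_plus_X_power)
  qed
  have "(cluster_fps {1..t} k ^ m :: 'a fps) $ (n - m) = ((fps_X * cluster_fps {1..t} k) ^ m) $ n"
    using assms(2) by (simp add: power_mult_distrib fps_X_power_mult_nth)
  also have "\<dots> = (\<Sum>a\<le>m. \<Sum>b\<le>m - a.
      (of_nat ((m choose a) * ((m - a) choose b)) * ?Y ^ a * ?V ^ b * (- 1) ^ (m - a - b)) $ n)"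
    by (simp only: X_mult_cluster_fps_initial[OF assms(1)] trinomial_ring fps_sum_nth)
  finally show ?thesis
    using assms(2) by (simp add: term_nth del: of_nat_mult)
qed

lemma card_des_left_initial:
  assumes "t \<le> k"
  shows "(of_nat (card {w \<in> words k n. des_left {1..t} w = s}) :: 'a::{idom, ring_char_0})
     = (\<Sum>m\<le>n. \<Sum>a\<le>m. \<Sum>b\<le>m - a. (- 1) ^ (m - a - b) * (- 1) ^ (n - m - s)
          * of_nat ((n - m) choose s)
          * of_nat (m choose a) * of_nat ((m - a) choose b)
          * of_nat ((t * a) choose (n - b)) * of_nat (k - t) ^ b)"
  unfolding card_des_left
  by (intro sum.cong refl)
     (simp add: cluster_fps_initial_power_nth assms sum_distrib_left mult_ac del: One_nat_def)

subsection \<open>Rises as descents of the complement\<close>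

lemma ris_left_map_strict_antimono:
  assumes "strict_antimono_on A f" "set w \<subseteq> A" "X \<subseteq> A"
  shows "ris_left (f ` X) (map f w) = des_left X w"
proof -
  have less: "f x < f y \<longleftrightarrow> y < x" if "x \<in> A" "y \<in> A" for x y
    using that assms(1) by (metis less_asym monotone_onD not_less_iff_gr_or_eq)
  have "inj_on f A"
    using assms(1) by (simp add: strict_antimono_iff_antimono)
  then have mem: "f x \<in> f ` X \<longleftrightarrow> x \<in> X" if "x \<in> A" for x
    using that assms(3) by (rule inj_on_image_mem_iff)
  have "w ! i \<in> A" if "i < length w" for i
    using that assms(2) by auto
  then show ?thesis
    unfolding ris_left_def des_left_def
    by (intro arg_cong[of _ _ card] Collect_cong) (simp add: less mem Suc_lessD cong: conj_cong)
qed

lemma card_ris_left_complement: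
  assumes "X \<subseteq> {1..k}"
  shows "card {w \<in> words k n. ris_left ((\<lambda>x. k + 1 - x) ` X) w = s}
           = card {w \<in> words k n. des_left X w = s}"
proof -
  let ?f = "\<lambda>x. k + 1 - x"
  have involution: "map ?f (map ?f w) = w" if "w \<in> words k n" for w
    using that by (auto simp: words_def intro!: map_idI)
  have closed: "map ?f w \<in> words k n" if "w \<in> words k n" for w
    using that by (fastforce simp: words_def)
  have "strict_antimono_on {1..k} ?f"
    by (auto intro!: monotone_onI)
  then have ris: "ris_left (?f ` X) (map ?f w) = des_left X w" if "w \<in> words k n" for w
    using that assms by (intro ris_left_map_strict_antimono) (auto simp: words_def)
  have "bij_betw (map ?f) {w \<in> words k n. des_left X w = s}
          {w \<in> words k n. ris_left (?f ` X) w = s}"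
    by (rule bij_betw_byWitness[where f' = "map ?f"])
       (use involution closed ris ris[OF closed] in \<open>auto simp del: map_map One_nat_def\<close>)
  then show ?thesis
    by (simp add: bij_betw_same_card)
qed

lemma complement_initial_segment:
  fixes t k :: nat
  assumes "t \<le> k"
  shows "(\<lambda>x. k + 1 - x) ` {1..t} = {k + 1 - t..k}"
proof
  show "{k + 1 - t..k} \<subseteq> (\<lambda>x. k + 1 - x) ` {1..t}"
  proof
    fix y assume "y \<in> {k + 1 - t..k}"
    with assms show "y \<in> (\<lambda>x. k + 1 - x) ` {1..t}"
      by (intro image_eqI[of _ _ "k + 1 - y"]) auto
  qed
qed auto

lemma minus_one_powi_diff:
  assumes "m \<le> n" "a \<le> m" "b \<le> m - a" "s \<le> n - m"
  shows "(- 1 :: 'a::field) powi (int n - int a - int b - int s)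
           = (- 1) ^ (m - a - b) * (- 1) ^ (n - m - s)"
proof -
  have "int n - int a - int b - int s = int (m - a - b + (n - m - s))"
    using assms by simp
  then show ?thesis
    by (simp only: power_int_of_nat power_add)
qed

theorem theorem4p1:
  fixes t k n s :: nat
  assumes "1 \<le> t" and "t \<le> k"
  shows "card {w \<in> words k n. des_left {1..t} w = s}
           = card {w \<in> words k n. ris_left {k + 1 - t..k} w = s}
       \<and> real (card {w \<in> words k n. des_left {1..t} w = s})
           = (\<Sum>m = 0..n. \<Sum>a = 0..m. \<Sum>b = 0..m - a.
                (- 1) powi (int n - int a - int b - int s)
                * real (m choose a) * real ((m - a) choose b)
                * real ((t * a) choose (n - b)) * real ((n - m) choose s)
                * (real k - real t) ^ b)"
proof
  show "card {w \<in> words k n. des_left {1..t} w = s}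
      = card {w \<in> words k n. ris_left {k + 1 - t..k} w = s}"
    using card_ris_left_complement[of "{1..t}" k n s] assms(2)
    by (simp only: complement_initial_segment) simp
  show "real (card {w \<in> words k n. des_left {1..t} w = s})
      = (\<Sum>m = 0..n. \<Sum>a = 0..m. \<Sum>b = 0..m - a.
                (- 1) powi (int n - int a - int b - int s)
                * real (m choose a) * real ((m - a) choose b)
                * real ((t * a) choose (n - b)) * real ((n - m) choose s)
                * (real k - real t) ^ b)"
    unfolding card_des_left_initial[OF assms(2)] atLeast0AtMost
    by (intro sum.cong refl)
       (auto simp: minus_one_powi_diff assms of_nat_diff not_less)
qed

end
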